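(* Let $q$ be even. Let $\mathcal{C}$ be the $[q+2,q-1,4]_q$ GTRS code (of covering radius $2$) whose parity check matrix has as columns nonzero scalar multiples of $(1,t,t^2)^{tr}$, $t\in\mathbb{F}_q$, of $(0,0,1)^{tr}$ and of $(0,1,0)^{tr}$ (the points of a regular hyperoval in $\mathrm{PG}(2,q)$). Put $n=q+2$. Then $\mathcal{C}$ has $(q+2)(q-1)$ cosets of weight $1$, all with weight distribution $D_1$; it has $(q-1)(q^2-1)$ cosets of weight $2$, all with weight distribution $D_2(i_1)$, $i_1=\frac{q+2}{2}$; and it has no cosets of weight $3$.
   Context: For an $[n,n-3,4]_q$ code $\mathcal{C}$ (linear, length $n$, dimension $n-3$, minimum distance $4$), a coset is a translate $\mathcal{C}+\mathbf{v}$; its weight is the smallest Hamming weight of a vector in it. The covering radius is the least $R$ such that every vector of $\mathbb{F}_q^n$ is within Hamming distance $R$ of a codeword. $A_w(\mathcal{C})$ (resp. $B_w(\mathcal{V})$) is the number of vectors of Hamming weight $w$ in $\mathcal{C}$ (resp. in the coset $\mathcal{V}$). Put $\Omega_w^{(v)}(n,4)=(-1)^{w-4}\binom{n-v}{w-v}\binom{w-1-v}{2-v}$. A coset $\mathcal{V}$ has weight distribution: - $D_1$ if $B_0=B_2=0$, $B_1=1$, $B_3=\binom{n-1}{3}$, and $B_w=A_w(\mathcal{C})-\Omega_w^{(0)}(n,4)+\Omega_w^{(1)}(n,4)$ for $w=4,\ldots,n$; - $D_2(i)$ if $B_0=B_1=0$, $B_2=i$, and $B_w=A_w(\mathcal{C})-\Omega_w^{(0)}(n,4)+(-1)^w\binom{n-2}{n-w}i$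 for $w=3,\ldots,n$; where $B_w=B_w(\mathcal{V})$. *)

theory Defs
  imports "HOL-Analysis.Analysis"
begin

text \<open>Vectors of \<open>F\<^sub>q\<^sup>n\<close> are elements of \<open>'a ^ 'n\<close>, where \<open>'a\<close> is a finite field with \<open>q\<close>
  elements and the coordinates are indexed by a finite type \<open>'n\<close> with \<open>n\<close> elements.\<close>

definition hamming_weight :: "'a::zero ^ 'n \<Rightarrow> nat" where
  "hamming_weight x = card {i. x $ i \<noteq> 0}"

definition hamming_dist :: "'a ^ 'n \<Rightarrow> 'a ^ 'n \<Rightarrow> nat" where
  "hamming_dist x y = card {i. x $ i \<noteq> y $ i}"

definition min_distance :: "('a ^ 'n) set \<Rightarrow> nat" where
  "min_distance C = (LEAST d. \<exists>x\<in>C. \<exists>y\<in>C. x \<noteq> y \<and> hamming_dist x y = d)"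

definition covering_radius :: "('a ^ 'n) set \<Rightarrow> nat" where
  "covering_radius C = (LEAST R. \<forall>v. \<exists>c\<in>C. hamming_dist v c \<le> R)"

definition linear_code :: "nat \<Rightarrow> nat \<Rightarrow> nat \<Rightarrow> ('a::{field,finite} ^ 'n) set \<Rightarrow> bool" where
  "linear_code n k d C \<longleftrightarrow>
     CARD('n) = n \<and> vec.subspace C \<and> vec.dim C = k \<and> min_distance C = d"

definition parity_check_code :: "'a::field ^ 'n ^ 'm \<Rightarrow> ('a ^ 'n) set" where
  "parity_check_code H = {x. H *v x = 0}"

definition cosets :: "('a::plus ^ 'n) set \<Rightarrow> ('a ^ 'n) set set" where
  "cosets C = {(\<lambda>c. c + v) ` C | v. True}"

definition coset_weight :: "('a::zero ^ 'n) set \<Rightarrow> nat" where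
  "coset_weight V = (LEAST w. \<exists>x\<in>V. hamming_weight x = w)"

text \<open>For a code this is \<open>A\<^sub>w(C)\<close>, for a coset it is \<open>B\<^sub>w(V)\<close>.\<close>

definition weight_count :: "nat \<Rightarrow> ('a::zero ^ 'n) set \<Rightarrow> nat" where
  "weight_count w V = card {x \<in> V. hamming_weight x = w}"

text \<open>\<open>Omega4 v w n\<close> is \<open>\<Omega>\<^sub>w\<^sup>(\<^sup>v\<^sup>)(n,4)\<close>. It is real-valued with an integer exponent because
  \<open>w = 3\<close> is used in \<open>D\<^sub>2(i)\<close>, where the exponent \<open>w - 4\<close> is negative. In all uses below \<open>w \<ge> 3\<close>
  with \<open>v = 0\<close>, or \<open>w \<ge> 4\<close> with \<open>v = 1\<close>, so the natural-number subtractions are exact.\<close>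

definition Omega4 :: "nat \<Rightarrow> nat \<Rightarrow> nat \<Rightarrow> real" where
  "Omega4 v w n = (-1) powi (int w - 4) *
     real ((n - v) choose (w - v)) * real ((w - 1 - v) choose (2 - v))"

definition dist_D1 :: "nat \<Rightarrow> ('a::zero ^ 'n) set \<Rightarrow> ('a ^ 'n) set \<Rightarrow> bool" where
  "dist_D1 n C V \<longleftrightarrow>
     weight_count 0 V = 0 \<and> weight_count 2 V = 0 \<and> weight_count 1 V = 1 \<and>
     weight_count 3 V = (n - 1) choose 3 \<and>
     (\<forall>w\<in>{4..n}. real (weight_count w V) =
        real (weight_count w C) - Omega4 0 w n + Omega4 1 w n)"

definition dist_D2 :: "nat \<Rightarrow> nat \<Rightarrow> ('a::zero ^ 'n) set \<Rightarrow> ('a ^ 'n) set \<Rightarrow> bool" where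
  "dist_D2 i n C V \<longleftrightarrow>
     weight_count 0 V = 0 \<and> weight_count 1 V = 0 \<and> weight_count 2 V = i \<and>
     (\<forall>w\<in>{3..n}. real (weight_count w V) =
        real (weight_count w C) - Omega4 0 w n + (-1) ^ w * real ((n - 2) choose (n - w)) * real i)"

definition hyperoval_points :: "('a::field ^ 3) set" where
  "hyperoval_points = range (\<lambda>t. vector [1, t, t\<^sup>2]) \<union> {vector [0, 0, 1], vector [0, 1, 0]}"

text \<open>Each of the \<open>q + 2\<close> representatives gives exactly one column, up to a nonzero scalar; the
  order of the columns is arbitrary.\<close>

definition hyperoval_parity_check :: "'a::field ^ 'n ^ 3 \<Rightarrow> bool" where
  "hyperoval_parity_check H \<longleftrightarrow>
     (\<exists>p c. bij_betw p (UNIV :: 'n set) hyperoval_points \<and>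
            (\<forall>j. c j \<noteq> 0 \<and> column j H = c j *s p j))"

end

theory Submission
  imports Defs
begin

text \<open>The cosets of \<open>C\<close> are the fibres of the syndrome map \<open>x \<mapsto> H *v x\<close>. Since any three columns of \<open>H\<close>
  are independent, every coset contains exactly \<open>q\<^bsup>j - 3\<^esup>\<close> vectors supported in a given set of
  \<open>j \<ge> 3\<close> coordinates. Summing over all such sets gives triangular equations which, for every
  coset, determine \<open>B\<^sub>3, \<dots>, B\<^sub>n\<close> from \<open>B\<^sub>0, B\<^sub>1, B\<^sub>2\<close>; the distributions \<open>D\<^sub>1\<close> and \<open>D\<^sub>2(i)\<close> are verified by
  substitution.

  Vectors of weight 2 with the same syndrome have disjoint supports, so \<open>B\<^sub>2 \<le> n / 2\<close>. When
  \<open>n = q + 2\<close>, the total number of vectors of weight 2 equals \<open>n / 2\<close> times the number of cosets without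
  vectors of weight at most 1, so each of these cosets has \<open>B\<^sub>2 = n / 2\<close>. The geometry of the hyperoval
  thus enters only through the independence of any three of its points.\<close>

section \<open>Alternating binomial sums and a triangular binomial transform\<close>

text \<open>A \<open>k\<close>-th finite difference kills a polynomial of degree
  \<open>r < k\<close>: trinomial revision pulls out \<open>k choose r\<close> and leaves the
  expansion of \<open>(1 - 1) ^ (k - r)\<close>.\<close>

lemma choose_alternating_choose_sum:
  fixes k r :: nat
  assumes "r < k"
  shows "(\<Sum>i\<le>k. (-1) ^ i * real (k choose i) * real (i choose r)) = 0"
proof -
  have "(\<Sum>i\<le>k. (-1) ^ i * real (k choose i) * real (i choose r)) =
        (\<Sum>i\<in>{r..k}. (-1) ^ i * real (k choose i) * real (i choose r))"
    by (rule sum.mono_neutral_right) auto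
  also have "\<dots> = (\<Sum>i\<in>{0 + r..(k - r) + r}. (-1) ^ i * real (k choose i) * real (i choose r))"
    using assms by simp
  also have "\<dots> = (\<Sum>i\<in>{0..k - r}. (-1) ^ (i + r) * real (k choose (i + r)) * real ((i + r) choose r))"
    by (rule sum.shift_bounds_cl_nat_ivl)
  also have "\<dots> = (\<Sum>i\<in>{0..k - r}. (-1) ^ r * real (k choose r) * ((-1) ^ i * real ((k - r) choose i)))"
  proof (rule sum.cong)
    fix i assume i: "i \<in> {0..k - r}"
    then have "(k choose (i + r)) * ((i + r) choose r) = (k choose r) * ((k - r) choose i)"
      using choose_mult[of r "i + r" k] assms by simp
    then have "real (k choose (i + r)) * real ((i + r) choose r) = real (k choose r) * real ((k - r) choose i)"
      by (metis of_nat_mult)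
    then show "(-1) ^ (i + r) * real (k choose (i + r)) * real ((i + r) choose r) =
      (-1) ^ r * real (k choose r) * ((-1) ^ i * real ((k - r) choose i))"
      by (simp add: power_add mult.assoc)
  qed simp
  also have "\<dots> = 0"
    using choose_alternating_sum[of "k - r", where 'a = real] assms
    by (simp add: sum_distrib_left[symmetric] atMost_atLeast0)
  finally show ?thesis .
qed

text \<open>Trinomial revision again: \<open>(n - v choose w - v) * (n - w choose j - w) = (n - v
  choose j - v) * (j - v choose w - v)\<close>, so the transform becomes a finite difference of
  \<open>g\<close> of order \<open>j - v\<close>.\<close>

lemma alternating_binomial_transform:
  fixes g :: "nat \<Rightarrow> real"
  assumes "v \<le> j" "j \<le> n"
  shows "(\<Sum>w\<le>j. (if w < v then 0 else (-1) ^ w * real ((n - v) choose (w - v)) * g w) *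
            real ((n - w) choose (j - w))) =
         (-1) ^ v * real ((n - v) choose (j - v)) *
            (\<Sum>i\<le>j - v. (-1) ^ i * real ((j - v) choose i) * g (i + v))"
proof -
  have "(\<Sum>w\<le>j. (if w < v then 0 else (-1) ^ w * real ((n - v) choose (w - v)) * g w) *
            real ((n - w) choose (j - w))) =
        (\<Sum>w\<in>{0 + v..(j - v) + v}. (-1) ^ w * real ((n - v) choose (w - v)) * g w *
            real ((n - w) choose (j - w)))"
    by (rule sum.mono_neutral_cong_right) (use assms in auto)
  also have "\<dots> = (\<Sum>i\<in>{0..j - v}. (-1) ^ (i + v) * real ((n - v) choose (i + v - v)) * g (i + v) *
            real ((n - (i + v)) choose (j - (i + v))))"
    by (rule sum.shift_bounds_cl_nat_ivl)
  also have "\<dots> = (\<Sum>i\<le>j - v. (-1) ^ v * real ((n - v) choose (j - v)) *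
            ((-1) ^ i * real ((j - v) choose i) * g (i + v)))"
  proof (rule sum.cong)
    fix i assume "i \<in> {..j - v}"
    then have i: "i \<le> j - v" by simp
    have "((n - v) choose (j - v)) * ((j - v) choose i) =
          ((n - v) choose i) * ((n - v - i) choose (j - v - i))"
      by (rule choose_mult) (use i assms in auto)
    moreover have "n - v - i = n - (i + v)" "j - v - i = j - (i + v)" by simp_all
    ultimately have "real ((n - v) choose i) * real ((n - (i + v)) choose (j - (i + v))) =
          real ((n - v) choose (j - v)) * real ((j - v) choose i)"
      by (metis of_nat_mult)
    then show "(-1) ^ (i + v) * real ((n - v) choose (i + v - v)) * g (i + v) *
            real ((n - (i + v)) choose (j - (i + v))) =
          (-1) ^ v * real ((n - v) choose (j - v)) * ((-1) ^ i * real ((j - v) choose i) * g (i + v))"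
      by (simp add: power_add mult.assoc mult.left_commute)
  qed (simp add: atMost_atLeast0)
  finally show ?thesis by (simp add: sum_distrib_left)
qed

text \<open>The \<open>j\<close>-th equation has coefficient \<open>n - j choose 0 = 1\<close> at
  \<open>w = j\<close>, so the system is unitriangular and can be solved upwards from
  \<open>m\<close>.\<close>

lemma binomial_transform_unique:
  fixes d e :: "nat \<Rightarrow> real"
  assumes init: "\<And>w. w < m \<Longrightarrow> d w = e w"
    and trans: "\<And>j. m \<le> j \<Longrightarrow> j \<le> n \<Longrightarrow>
      (\<Sum>w\<le>j. d w * real ((n - w) choose (j - w))) = (\<Sum>w\<le>j. e w * real ((n - w) choose (j - w)))"
  shows "w \<le> n \<Longrightarrow> d w = e w"
proof (induction w rule: less_induct)
  case (less w)
  show ?case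
  proof (cases "w < m")
    case False
    have "(\<Sum>v<w. d v * real ((n - v) choose (w - v))) = (\<Sum>v<w. e v * real ((n - v) choose (w - v)))"
      by (rule sum.cong) (use less in auto)
    with trans[of w] False less.prems show ?thesis
      by (simp add: lessThan_Suc_atMost[symmetric])
  qed (use init in simp)
qed

section \<open>Counting vectors by dimension, support and weight\<close>

lemma card_vec_subspace:
  fixes S :: "('a::{field,finite} ^ 'n) set"
  assumes "vec.subspace S"
  shows "card S = CARD('a) ^ vec.dim S"
proof -
  obtain B where B: "B \<subseteq> S" "vec.independent B" "S \<subseteq> vec.span B" "card B = vec.dim S"
    by (rule vec.basis_exists)
  have fin: "finite B" by simp
  have span: "S = vec.span B"
    using B assms by (simp add: subset_antisym vec.span_minimal)
  let ?f = "\<lambda>u. \<Sum>b\<in>B. u b *s b"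
  have inj: "inj_on ?f (B \<rightarrow>\<^sub>E UNIV)"
  proof (rule inj_onI)
    fix u v assume u: "u \<in> B \<rightarrow>\<^sub>E UNIV" and v: "v \<in> B \<rightarrow>\<^sub>E UNIV" and eq: "?f u = ?f v"
    have "(\<Sum>b\<in>B. (u b - v b) *s b) = 0"
      using eq by (simp add: vec.scale_left_diff_distrib sum_subtractf)
    then have "u b - v b = 0" if "b \<in> B" for b
      using vec.independentD[OF B(2) fin subset_refl, of "\<lambda>b. u b - v b"] that by simp
    then show "u = v"
      using u v by (intro PiE_ext[of u B _ v]) auto
  qed
  have img: "?f ` (B \<rightarrow>\<^sub>E UNIV) = S"
  proof -
    have "?f u \<in> ?f ` (B \<rightarrow>\<^sub>E UNIV)" for u
      by (rule image_eqI[of _ _ "restrict u B"]) auto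
    then have "range ?f = ?f ` (B \<rightarrow>\<^sub>E UNIV)" by auto
    then show ?thesis using span vec.span_finite[OF fin] by simp
  qed
  have "card S = card (B \<rightarrow>\<^sub>E (UNIV :: 'a set))"
    using card_image[OF inj] unfolding img .
  then show ?thesis using B(4) by (simp add: card_PiE)
qed

text \<open>With \<open>T\<close> the support of a vector of weight \<open>w\<close>, this is the
  coefficient in the binomial transform.\<close>

lemma card_supersets:
  fixes T :: "'n::finite set"
  assumes "card T \<le> j"
  shows "card {S. card S = j \<and> T \<subseteq> S} = (CARD('n) - card T) choose (j - card T)"
proof -
  have "bij_betw (\<lambda>S. S - T) {S. card S = j \<and> T \<subseteq> S} {U. U \<subseteq> - T \<and> card U = j - card T}"
  proof (rule bij_betw_byWitness[where f' = "\<lambda>U. U \<union> T"])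
    show "(\<lambda>U. U \<union> T) ` {U. U \<subseteq> - T \<and> card U = j - card T} \<subseteq> {S. card S = j \<and> T \<subseteq> S}"
    proof (rule image_subsetI)
      fix U assume U: "U \<in> {U. U \<subseteq> - T \<and> card U = j - card T}"
      then have "U \<inter> T = {}" by blast
      then show "U \<union> T \<in> {S. card S = j \<and> T \<subseteq> S}"
        using U assms by (simp add: card_Un_disjoint)
    qed
  qed (auto simp: card_Diff_subset)
  then have "card {S. card S = j \<and> T \<subseteq> S} = card {U. U \<subseteq> - T \<and> card U = j - card T}"
    by (rule bij_betw_same_card)
  also have "\<dots> = card (- T) choose (j - card T)" by (rule n_subsets) simp
  finally show ?thesis by (simp add: Compl_eq_Diff_UNIV card_Diff_subset)
qed

abbreviation support :: "'a::zero ^ 'n \<Rightarrow> 'n set" where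
  "support x \<equiv> {i. x $ i \<noteq> 0}"

lemma hamming_weight_eq_0_iff [simp]: "hamming_weight x = 0 \<longleftrightarrow> x = 0"
  by (auto simp: hamming_weight_def vec_eq_iff)

lemma hamming_weight_zero [simp]: "hamming_weight 0 = 0"
  by simp

text \<open>The support of \<open>x - y\<close> lies in the union of the supports. The overlap term
  is kept because it is what separates the supports of two vectors of weight 2 with the same
  syndrome.\<close>

lemma hamming_weight_diff_le:
  fixes x y :: "'a::ab_group_add ^ 'n"
  shows "hamming_weight (x - y) + card (support x \<inter> support y) \<le> hamming_weight x + hamming_weight y"
proof -
  have "hamming_weight (x - y) \<le> card (support x \<union> support y)"
    unfolding hamming_weight_def by (rule card_mono) auto
  moreover have "card (support x) + card (support y) =
      card (support x \<union> support y) + card (support x \<inter> support y)"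
    by (rule card_Un_Int) auto
  ultimately show ?thesis by (simp add: hamming_weight_def)
qed

lemma hamming_dist_eq_weight:
  fixes x y :: "'a::ab_group_add ^ 'n"
  shows "hamming_dist x y = hamming_weight (x - y)"
  by (simp add: hamming_dist_def hamming_weight_def)

lemma hamming_weight_le: "hamming_weight (x :: 'a::zero ^ 'n) \<le> CARD('n)"
  unfolding hamming_weight_def by (rule card_mono) auto


lemma support_subset_iff: "support x \<subseteq> S \<longleftrightarrow> (\<forall>i. i \<notin> S \<longrightarrow> x $ i = 0)"
  by blast

lemma card_supported:
  fixes S :: "'n::finite set"
  shows "card {x :: 'a::{field,finite} ^ 'n. support x \<subseteq> S} = CARD('a) ^ card S"
proof -
  have "vec.subspace {x :: 'a ^ 'n. \<forall>i. i \<notin> S \<longrightarrow> x $ i = 0}"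
    by (auto intro!: vec.subspaceI)
  from card_vec_subspace[OF this] show ?thesis
    by (simp add: dim_substandard_cart support_subset_iff)
qed

lemma card_support_eq:
  fixes S :: "'n::finite set"
  shows "card {x :: 'a::{zero,finite} ^ 'n. support x = S} = (CARD('a) - 1) ^ card S"
proof -
  have "bij_betw (\<lambda>x. restrict (\<lambda>i. x $ i) S) {x :: 'a ^ 'n. support x = S} (S \<rightarrow>\<^sub>E UNIV - {0})"
    by (rule bij_betw_byWitness[where f' = "\<lambda>f. \<chi> i. if i \<in> S then f i else 0"])
      (auto simp: vec_eq_iff fun_eq_iff PiE_iff extensional_def)
  then have "card {x :: 'a ^ 'n. support x = S} = card (S \<rightarrow>\<^sub>E (UNIV - {0 :: 'a}))"
    by (rule bij_betw_same_card)
  then show ?thesis by (simp add: card_PiE card_Diff_singleton)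
qed

lemma card_hamming_weight_eq:
  "card {x :: 'a::{zero,finite} ^ 'n. hamming_weight x = w} = (CARD('n) choose w) * (CARD('a) - 1) ^ w"
proof -
  have "{x :: 'a ^ 'n. hamming_weight x = w} = (\<Union>S\<in>{S. S \<subseteq> UNIV \<and> card S = w}. {x. support x = S})"
    by (auto simp: hamming_weight_def)
  also have "card \<dots> = (\<Sum>S\<in>{S. S \<subseteq> (UNIV :: 'n set) \<and> card S = w}. card {x :: 'a ^ 'n. support x = S})"
    by (rule card_UN_disjoint) auto
  also have "\<dots> = (\<Sum>S\<in>{S. S \<subseteq> (UNIV :: 'n set) \<and> card S = w}. (CARD('a) - 1) ^ w)"
    by (rule sum.cong) (auto simp: card_support_eq)
  also have "\<dots> = card {S. S \<subseteq> (UNIV :: 'n set) \<and> card S = w} * (CARD('a) - 1) ^ w"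
    by simp
  also have "card {S. S \<subseteq> (UNIV :: 'n set) \<and> card S = w} = CARD('n) choose w"
    by (rule n_subsets) simp
  finally show ?thesis .
qed

lemma card_field_ge_2: "CARD('a::{field,finite}) \<ge> 2"
  using card_mono[of "UNIV :: 'a set" "{0, 1}"] by simp

section \<open>The terms of the weight formulas and their vanishing transforms\<close>

text \<open>The closed forms of \<open>\<Omega>\<^sub>w\<^sup>(\<^sup>0\<^sup>)\<close> and \<open>\<Omega>\<^sub>w\<^sup>(\<^sup>1\<^sup>)\<close> below replace the binomials with truncated
  subtraction by polynomials in \<open>w\<close>; extended to \<open>w < 3\<close> they also produce the correct
  \<open>B\<^sub>0, B\<^sub>1, B\<^sub>2\<close>.\<close>

lemma Omega4_0: "w \<ge> 3 \<Longrightarrow> Omega4 0 w n = (-1) ^ w * real (n choose w) * (real (w choose 2) - real w + 1)"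
proof -
  assume "w \<ge> 3"
  then obtain v where v: "w = Suc v" by (cases w) auto
  have "(-1::real) powi (int w - 4) = (-1) ^ w"
    by (simp add: power_int_diff)
  \<comment> \<open>By Pascal's rule,
    \<open>(w - 1) choose 2 = (w choose 2) - w + 1\<close>.\<close>
  then show ?thesis
    by (simp add: Omega4_def v numeral_2_eq_2)
qed

lemma Omega4_1: "w \<ge> 3 \<Longrightarrow> Omega4 1 w n = (-1) ^ w * real ((n - 1) choose (w - 1)) * (real w - 2)"
proof -
  assume w: "w \<ge> 3"
  have "(-1::real) powi (int w - 4) = (-1) ^ w"
    by (simp add: power_int_diff)
  then show ?thesis
    using w by (simp add: Omega4_def of_nat_diff)
qed

text \<open>The transform is a finite difference of order \<open>j\<close> of a polynomial of degree
  2, hence zero for \<open>j \<ge> 3\<close>. The next two lemmas have order \<open>j - 1\<close>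
  with degree 1, and order \<open>j - 2\<close> with degree 0.\<close>

lemma Omega4_0_transform:
  assumes "3 \<le> j" "j \<le> n"
  shows "(\<Sum>w\<le>j. (-1) ^ w * real (n choose w) * (real (w choose 2) - real w + 1) *
    real ((n - w) choose (j - w))) = 0"
proof -
  have "(\<Sum>i\<le>j. (-1) ^ i * real (j choose i) * (real (i choose 2) - real i + 1)) =
    (\<Sum>i\<le>j. (-1) ^ i * real (j choose i) * real (i choose 2)) -
    (\<Sum>i\<le>j. (-1) ^ i * real (j choose i) * real (i choose 1)) +
    (\<Sum>i\<le>j. (-1) ^ i * real (j choose i) * real (i choose 0))"
    by (simp add: algebra_simps sum.distrib sum_subtractf)
  then have "(\<Sum>i\<le>j. (-1) ^ i * real (j choose i) * (real (i choose 2) - real i + 1)) = 0"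
    using assms by (simp only: choose_alternating_choose_sum)
  then show ?thesis
    using alternating_binomial_transform[of 0 j n "\<lambda>w. real (w choose 2) - real w + 1"] assms by simp
qed

text \<open>The guard \<open>w < 1\<close> is needed because truncated \<open>w - 1\<close> is 0 at
  \<open>w = 0\<close> and would give a spurious binomial 1.\<close>

lemma Omega4_1_transform:
  assumes "3 \<le> j" "j \<le> n"
  shows "(\<Sum>w\<le>j. (if w < 1 then 0 else (-1) ^ w * real ((n - 1) choose (w - 1)) * (real w - 2)) *
    real ((n - w) choose (j - w))) = 0"
proof -
  have "(\<Sum>i\<le>j - 1. (-1) ^ i * real ((j - 1) choose i) * (real (i + 1) - 2)) =
    (\<Sum>i\<le>j - 1. (-1) ^ i * real ((j - 1) choose i) * real (i choose 1)) -
    (\<Sum>i\<le>j - 1. (-1) ^ i * real ((j - 1) choose i) * real (i choose 0))"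
    by (simp add: algebra_simps sum.distrib sum_subtractf)
  then have "(\<Sum>i\<le>j - 1. (-1) ^ i * real ((j - 1) choose i) * (real (i + 1) - 2)) = 0"
    using assms by (simp only: choose_alternating_choose_sum)
  then show ?thesis
    using alternating_binomial_transform[of 1 j n "\<lambda>w. real w - 2"] assms by simp
qed

lemma Omega4_2_transform:
  assumes "3 \<le> j" "j \<le> n"
  shows "(\<Sum>w\<le>j. (if w < 2 then 0 else (-1) ^ w * real ((n - 2) choose (w - 2)) * c) *
    real ((n - w) choose (j - w))) = 0"
proof -
  have "(\<Sum>i\<le>j - 2. (-1) ^ i * real ((j - 2) choose i) * c) =
    c * (\<Sum>i\<le>j - 2. (-1) ^ i * real ((j - 2) choose i) * real (i choose 0))"
    by (simp add: sum_distrib_left algebra_simps)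
  also have "\<dots> = 0"
    using assms by (simp only: choose_alternating_choose_sum)
  finally show ?thesis
    using alternating_binomial_transform[of 2 j n "\<lambda>w. c"] assms by simp
qed

section \<open>Syndrome fibres of a parity check matrix with three rows\<close>

text \<open>\<open>light_kernel\<close> encodes the independence of any three columns as a bound on
  the weights in the kernel; \<open>length_ge\<close> makes a triple of columns available.\<close>

locale distance_four_parity_check =
  fixes H :: "'a::{field,finite} ^ 'n ^ 3"
  assumes light_kernel: "H *v x = 0 \<Longrightarrow> hamming_weight x \<le> 3 \<Longrightarrow> x = 0"
    and length_ge: "CARD('n) \<ge> 3"
begin

definition fibre :: "'a ^ 3 \<Rightarrow> ('a ^ 'n) set" where
  "fibre s = {x. H *v x = s}"

text \<open>The difference lies in the kernel and has weight at most 3. Two typical uses: weights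
  with sum at most 3, and two vectors of weight 2 whose supports meet.\<close>

lemma fibre_eqI:
  assumes "x \<in> fibre s" "y \<in> fibre s"
    and "hamming_weight x + hamming_weight y \<le> 3 + card (support x \<inter> support y)"
  shows "x = y"
  using light_kernel[of "x - y"] assms hamming_weight_diff_le[of x y]
  by (simp add: fibre_def matrix_vector_mult_diff_distrib)

text \<open>Two vectors supported in \<open>S\<close> differ in at most three places, which gives
  injectivity; both sides have \<open>q^3\<close> elements.\<close>

lemma bij_betw_triple:
  assumes "card S = 3"
  shows "bij_betw ((*v) H) {x. support x \<subseteq> S} UNIV"
proof -
  have inj: "inj_on ((*v) H) {x. support x \<subseteq> S}"
  proof (rule inj_onI)
    fix x y assume "x \<in> {x. support x \<subseteq> S}" "y \<in> {x. support x \<subseteq> S}" and eq: "H *v x = H *v y"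
    then have "support (x - y) \<subseteq> S" unfolding support_subset_iff by simp
    then have "hamming_weight (x - y) \<le> 3"
      using card_mono[of S "support (x - y)"] assms by (simp add: hamming_weight_def)
    then have "x - y = 0"
      using eq by (intro light_kernel) (simp_all add: matrix_vector_mult_diff_distrib)
    then show "x = y" by simp
  qed
  moreover have "((*v) H) ` {x. support x \<subseteq> S} = UNIV"
  proof (rule card_subset_eq)
    show "card ((*v) H ` {x. support x \<subseteq> S}) = card (UNIV :: ('a ^ 3) set)"
      using assms by (simp add: card_image[OF inj] card_supported)
  qed auto
  ultimately show ?thesis by (simp add: bij_betw_def)
qed

lemma fibre_supported_nonempty:
  assumes "card S \<ge> 3"
  shows "\<exists>x\<in>fibre s. support x \<subseteq> S"
proof -
  obtain T where T: "T \<subseteq> S" "card T = 3"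
    using obtain_subset_with_card_n[OF assms] by metis
  have "s \<in> ((*v) H) ` {x. support x \<subseteq> T}"
    using bij_betw_triple[OF T(2)] by (simp add: bij_betw_def)
  then show ?thesis using T(1) by (auto simp: fibre_def)
qed

lemma fibre_nonempty: "\<exists>x. x \<in> fibre s"
  using fibre_supported_nonempty[of UNIV s] length_ge by auto

lemma inj_fibre: "inj fibre"
proof (rule injI)
  fix s t assume "fibre s = fibre t"
  then show "s = t" using fibre_nonempty[of s] by (auto simp: fibre_def)
qed

text \<open>Translation by a difference of two vectors supported in \<open>S\<close> matches the
  parts of any two fibres, so the \<open>q^(card S)\<close> supported vectors are spread evenly over
  the \<open>q^3\<close> syndromes.\<close>

lemma card_fibre_supported:
  assumes "card S \<ge> 3"
  shows "card {x \<in> fibre s. support x \<subseteq> S} = CARD('a) ^ (card S - 3)"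
proof -
  let ?K = "\<lambda>t. {x \<in> fibre t. support x \<subseteq> S}"
  have card_eq: "card (?K t) = card (?K s)" for t
  proof -
    obtain x where x: "x \<in> fibre s" "support x \<subseteq> S"
      using fibre_supported_nonempty[OF assms] by blast
    obtain y where y: "y \<in> fibre t" "support y \<subseteq> S"
      using fibre_supported_nonempty[OF assms] by blast
    have "bij_betw (\<lambda>z. z + (x - y)) (?K t) (?K s)"
      by (rule bij_betw_byWitness[where f' = "\<lambda>z. z - (x - y)"])
        (use x y in \<open>auto simp: fibre_def support_subset_iff matrix_vector_mult_diff_distrib
            matrix_vector_right_distrib\<close>)
    then show ?thesis by (rule bij_betw_same_card)
  qed
  have "CARD('a) ^ card S = (\<Sum>x\<in>{x :: 'a ^ 'n. support x \<subseteq> S}. 1)"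
    by (simp add: card_supported)
  also have "\<dots> = (\<Sum>t\<in>UNIV. of_nat (card {x \<in> {x. support x \<subseteq> S}. H *v x = t}) * 1)"
    by (rule sum_fun_comp) auto
  also have "\<dots> = (\<Sum>t\<in>UNIV. card (?K t))"
  proof (rule sum.cong)
    fix t
    have "{x \<in> {x. support x \<subseteq> S}. H *v x = t} = ?K t" by (auto simp: fibre_def)
    then show "of_nat (card {x \<in> {x. support x \<subseteq> S}. H *v x = t}) * 1 = card (?K t)" by simp
  qed simp
  also have "\<dots> = (\<Sum>t\<in>(UNIV :: ('a ^ 3) set). card (?K s))"
    by (rule sum.cong[OF refl card_eq])
  also have "\<dots> = CARD('a) ^ 3 * card (?K s)"
    by simp
  finally have "CARD('a) ^ 3 * card (?K s) = CARD('a) ^ 3 * CARD('a) ^ (card S - 3)"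
    using assms by (simp flip: power_add)
  then show ?thesis by simp
qed

section \<open>Weight distributions of the cosets\<close>

text \<open>Double count the pairs of a \<open>j\<close>-set \<open>S\<close> and a fibre vector
  supported in \<open>S\<close>. The right-hand side does not depend on \<open>s\<close>.\<close>

lemma weight_count_transform:
  assumes "3 \<le> j" "j \<le> CARD('n)"
  shows "(\<Sum>w\<le>j. weight_count w (fibre s) * ((CARD('n) - w) choose (j - w))) =
    (CARD('n) choose j) * CARD('a) ^ (j - 3)"
proof -
  \<comment> \<open>For \<open>w > j\<close> truncated subtraction would turn the binomial into 1
    instead of 0.\<close>
  let ?h = "\<lambda>w. if w \<le> j then (CARD('n) - w) choose (j - w) else 0"
  have sup: "card {S. card S = j \<and> support x \<subseteq> S} = ?h (hamming_weight x)" for x :: "'a ^ 'n"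
  proof (cases "hamming_weight x \<le> j")
    case True
    then show ?thesis using card_supersets[of "support x" j] by (simp add: hamming_weight_def)
  next
    case False
    then have "{S. card S = j \<and> support x \<subseteq> S} = {}"
      using card_mono[of _ "support x"] by (fastforce simp: hamming_weight_def)
    then show ?thesis using False by simp
  qed
  have "(\<Sum>S\<in>{S :: 'n set. card S = j}. card {x \<in> fibre s. support x \<subseteq> S}) =
        (\<Sum>x\<in>fibre s. ?h (hamming_weight x))"
    by (rule sum_multicount_gen) (auto simp: sup)
  also have "\<dots> = (\<Sum>w\<in>{..CARD('n)}. of_nat (card {x \<in> fibre s. hamming_weight x = w}) * ?h w)"
    by (rule sum_fun_comp) (auto simp: hamming_weight_le)
  also have "\<dots> = (\<Sum>w\<le>j. weight_count w (fibre s) * ((CARD('n) - w) choose (j - w)))"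
    by (rule sum.mono_neutral_cong_right) (use assms in \<open>auto simp: weight_count_def\<close>)
  finally have "(\<Sum>w\<le>j. weight_count w (fibre s) * ((CARD('n) - w) choose (j - w))) =
    (\<Sum>S\<in>{S :: 'n set. card S = j}. card {x \<in> fibre s. support x \<subseteq> S})" by simp
  also have "\<dots> = card {S :: 'n set. card S = j} * CARD('a) ^ (j - 3)"
    using assms by (simp add: card_fibre_supported)
  also have "card {S :: 'n set. card S = j} = CARD('n) choose j"
    using n_subsets[of "UNIV :: 'n set" j] by simp
  finally show ?thesis .
qed

lemma weight_count_eq_0:
  assumes "x \<in> fibre s" "hamming_weight x + w \<le> 3" "w \<noteq> hamming_weight x"
  shows "weight_count w (fibre s) = 0"
proof -
  have "{y \<in> fibre s. hamming_weight y = w} = {}"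
    using fibre_eqI[OF assms(1)] assms(2,3) by fastforce
  then show ?thesis unfolding weight_count_def by simp
qed

lemma weight_count_eq_1:
  assumes "x \<in> fibre s" "hamming_weight x \<le> 1"
  shows "weight_count (hamming_weight x) (fibre s) = 1"
proof -
  have "{y \<in> fibre s. hamming_weight y = hamming_weight x} = {x}"
    using fibre_eqI[OF assms(1)] assms by fastforce
  then show ?thesis unfolding weight_count_def by simp
qed

lemma zero_in_fibre_0: "0 \<in> fibre 0"
  by (simp add: fibre_def)

lemma weight_count_kernel:
  "weight_count 0 (fibre 0) = 1" "weight_count 1 (fibre 0) = 0"
  "weight_count 2 (fibre 0) = 0" "weight_count 3 (fibre 0) = 0"
  using weight_count_eq_1[OF zero_in_fibre_0] weight_count_eq_0[OF zero_in_fibre_0] by simp_all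

text \<open>All fibres have the same transforms from index 3 on, so a candidate \<open>e\<close> for
  the deviation from the code is correct once it fits for \<open>w < 3\<close> and its own
  transforms vanish.\<close>

lemma weight_count_difference:
  fixes e :: "nat \<Rightarrow> real"
  assumes "\<And>w. w < 3 \<Longrightarrow> real (weight_count w (fibre s)) = real (weight_count w (fibre 0)) + e w"
    and "\<And>j. 3 \<le> j \<Longrightarrow> j \<le> CARD('n) \<Longrightarrow> (\<Sum>w\<le>j. e w * real ((CARD('n) - w) choose (j - w))) = 0"
    and "w \<le> CARD('n)"
  shows "real (weight_count w (fibre s)) = real (weight_count w (fibre 0)) + e w"
proof (rule binomial_transform_unique[where m = 3 and n = "CARD('n)"])
  fix j assume j: "3 \<le> j" "j \<le> CARD('n)"
  have tr: "(\<Sum>w\<le>j. real (weight_count w (fibre t)) * real ((CARD('n) - w) choose (j - w))) =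
    real ((CARD('n) choose j) * CARD('a) ^ (j - 3))" for t
    using arg_cong[OF weight_count_transform[OF j, of t], of real] by simp
  show "(\<Sum>w\<le>j. real (weight_count w (fibre s)) * real ((CARD('n) - w) choose (j - w))) =
    (\<Sum>w\<le>j. (real (weight_count w (fibre 0)) + e w) * real ((CARD('n) - w) choose (j - w)))"
    unfolding distrib_right sum.distrib tr assms(2)[OF j] by simp
qed (use assms in auto)

lemma dist_D1_fibre:
  assumes "x \<in> fibre s" "hamming_weight x = 1"
  shows "dist_D1 (CARD('n)) (fibre 0) (fibre s)"
proof -
  let ?n = "CARD('n)"
  have B: "weight_count 0 (fibre s) = 0" "weight_count 1 (fibre s) = 1" "weight_count 2 (fibre s) = 0"
    using weight_count_eq_0[OF assms(1)] weight_count_eq_1[OF assms(1)] assms(2) by simp_all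
  \<comment> \<open>The closed form of \<open>Omega4 1 - Omega4 0\<close> continued below
    \<open>w = 3\<close>: its values at 0, 1, 2 are -1, 1, 0, which turn the counts 1, 0, 0 of the
    code into 0, 1, 0.\<close>
  let ?e = "\<lambda>w. (if w < 1 then 0 else (-1) ^ w * real ((?n - 1) choose (w - 1)) * (real w - 2)) -
    (-1) ^ w * real (?n choose w) * (real (w choose 2) - real w + 1)"
  have eq: "real (weight_count w (fibre s)) = real (weight_count w (fibre 0)) + ?e w" if "w \<le> ?n" for w
  proof (rule weight_count_difference[OF _ _ that])
    fix w :: nat assume "w < 3"
    then consider "w = 0" | "w = 1" | "w = 2" by linarith
    then show "real (weight_count w (fibre s)) = real (weight_count w (fibre 0)) + ?e w"
      by cases (use B weight_count_kernel in simp_all)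
  next
    fix j assume j: "3 \<le> j" "j \<le> ?n"
    show "(\<Sum>w\<le>j. ?e w * real ((?n - w) choose (j - w))) = 0"
      unfolding left_diff_distrib sum_subtractf Omega4_0_transform[OF j] Omega4_1_transform[OF j] by simp
  qed
  have gen: "real (weight_count w (fibre s)) =
      real (weight_count w (fibre 0)) - Omega4 0 w ?n + Omega4 1 w ?n" if "3 \<le> w" "w \<le> ?n" for w
    unfolding Omega4_0[OF that(1)] Omega4_1[OF that(1)] using eq[OF that(2)] that(1) by simp
  \<comment> \<open>At \<open>w = 3\<close> the general formula reads
    \<open>(n choose 3) - ((n - 1) choose 2)\<close>, since the code has no word of weight
    3.\<close>
  have "?n choose 3 = ((?n - 1) choose 2) + ((?n - 1) choose 3)"
    using length_ge by (cases ?n) (simp_all add: numeral_3_eq_3 numeral_2_eq_2)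
  then have "real (weight_count 3 (fibre s)) = real ((?n - 1) choose 3)"
    using gen[of 3] length_ge weight_count_kernel by (simp add: Omega4_def power_int_minus)
  then show ?thesis
    unfolding dist_D1_def using B gen by simp
qed

lemma dist_D2_fibre:
  assumes "weight_count 0 (fibre s) = 0" "weight_count 1 (fibre s) = 0" "weight_count 2 (fibre s) = i"
  shows "dist_D2 i (CARD('n)) (fibre 0) (fibre s)"
proof -
  let ?n = "CARD('n)"
  \<comment> \<open>Here the values at 0, 1, 2 are -1, 0, \<open>i\<close>.\<close>
  let ?e = "\<lambda>w. (if w < 2 then 0 else (-1) ^ w * real ((?n - 2) choose (w - 2)) * real i) -
    (-1) ^ w * real (?n choose w) * (real (w choose 2) - real w + 1)"
  have eq: "real (weight_count w (fibre s)) = real (weight_count w (fibre 0)) + ?e w" if "w \<le> ?n" for w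
  proof (rule weight_count_difference[OF _ _ that])
    fix w :: nat assume "w < 3"
    then consider "w = 0" | "w = 1" | "w = 2" by linarith
    then show "real (weight_count w (fibre s)) = real (weight_count w (fibre 0)) + ?e w"
      by cases (use assms weight_count_kernel in simp_all)
  next
    fix j assume j: "3 \<le> j" "j \<le> ?n"
    show "(\<Sum>w\<le>j. ?e w * real ((?n - w) choose (j - w))) = 0"
      unfolding left_diff_distrib sum_subtractf Omega4_0_transform[OF j] Omega4_2_transform[OF j] by simp
  qed
  have "real (weight_count w (fibre s)) = real (weight_count w (fibre 0)) - Omega4 0 w ?n +
      (-1) ^ w * real ((?n - 2) choose (?n - w)) * real i" if "3 \<le> w" "w \<le> ?n" for w
  proof -
    have "(?n - 2) choose (?n - w) = (?n - 2) choose (w - 2)"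
    proof -
      have "?n - 2 - (?n - w) = w - 2" using that by linarith
      then show ?thesis using binomial_symmetric[of "?n - w" "?n - 2"] that by simp
    qed
    then show ?thesis
      using eq[OF that(2)] that(1) by (simp add: Omega4_0)
  qed
  then show ?thesis
    unfolding dist_D2_def using assms by simp
qed

section \<open>Vectors of weight at most 2 and coset weights\<close>

lemma two_card_weight_2_le:
  "2 * weight_count 2 (fibre s) \<le> CARD('n)"
proof -
  let ?W = "{x \<in> fibre s. hamming_weight x = 2}"
  have "card (\<Union>x\<in>?W. support x) = (\<Sum>x\<in>?W. card (support x))"
  proof (rule card_UN_disjoint)
    show "\<forall>x\<in>?W. \<forall>y\<in>?W. x \<noteq> y \<longrightarrow> support x \<inter> support y = {}"
    proof (intro ballI impI)
      fix x y assume xy: "x \<in> ?W" "y \<in> ?W" "x \<noteq> y"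
      \<comment> \<open>One common coordinate would already meet the bound of
        \<open>fibre_eqI\<close>.\<close>
      then have "\<not> 4 \<le> 3 + card (support x \<inter> support y)"
        using fibre_eqI[of x s y] by auto
      then have "card (support x \<inter> support y) = 0" by linarith
      then show "support x \<inter> support y = {}" by simp
    qed
  qed auto
  also have "\<dots> = 2 * weight_count 2 (fibre s)"
    by (simp add: hamming_weight_def weight_count_def)
  finally have "2 * weight_count 2 (fibre s) = card (\<Union>x\<in>?W. support x)" by simp
  also have "\<dots> \<le> CARD('n)" by (rule card_mono) simp_all
  finally show ?thesis .
qed

text \<open>A lighter vector would have weight at most 1, so the two weights would sum to at most 3
  and \<open>fibre_eqI\<close> would identify the vectors.\<close>

lemma coset_weight_fibre:
  assumes "x \<in> fibre s" "hamming_weight x \<le> 2"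
  shows "coset_weight (fibre s) = hamming_weight x"
  unfolding coset_weight_def
proof (rule Least_equality)
  fix w assume "\<exists>y\<in>fibre s. hamming_weight y = w"
  then obtain y where y: "y \<in> fibre s" "hamming_weight y = w" by blast
  show "hamming_weight x \<le> w"
  proof (rule ccontr)
    assume "\<not> hamming_weight x \<le> w"
    then show False using fibre_eqI[OF assms(1) y(1)] y(2) assms(2) by auto
  qed
qed (use assms in blast)

text \<open>The coset through \<open>v\<close> is the fibre over \<open>H *v v\<close>, and
  surjectivity of \<open>H\<close> makes every fibre occur.\<close>

lemma cosets_eq_range_fibre: "cosets (fibre 0) = range fibre"
proof -
  have translate: "(\<lambda>c. c + v) ` fibre 0 = fibre (H *v v)" for v
  proof (intro set_eqI iffI)
    fix x assume "x \<in> fibre (H *v v)"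
    then have "x - v \<in> fibre 0" by (simp add: fibre_def matrix_vector_mult_diff_distrib)
    then show "x \<in> (\<lambda>c. c + v) ` fibre 0" by (intro image_eqI[of _ _ "x - v"]) auto
  qed (auto simp: fibre_def matrix_vector_right_distrib)
  have surj: "range ((*v) H) = UNIV"
  proof -
    have "s \<in> range ((*v) H)" for s
      using fibre_nonempty[of s] by (auto simp: fibre_def)
    then show ?thesis by blast
  qed
  have "cosets (fibre 0) = range (\<lambda>v. fibre (H *v v))"
    unfolding cosets_def translate by auto
  also have "\<dots> = fibre ` range ((*v) H)" by auto
  finally show ?thesis unfolding surj .
qed


section \<open>Counting cosets by their syndromes\<close>

text \<open>For \<open>w \<le> 2\<close> these are exactly the syndromes of the cosets of weight
  \<open>w\<close>; for larger \<open>w\<close> a fibre over such a syndrome may also contain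
  lighter vectors.\<close>

definition syndromes :: "nat \<Rightarrow> ('a ^ 3) set" where
  "syndromes w = (*v) H ` {x. hamming_weight x = w}"

lemma mem_syndromes_iff: "s \<in> syndromes w \<longleftrightarrow> (\<exists>x\<in>fibre s. hamming_weight x = w)"
  by (auto simp: syndromes_def fibre_def)

lemma syndromes_0: "syndromes 0 = {0}"
  by (auto simp: syndromes_def)

lemma syndromes_disjoint:
  assumes "v + w \<le> 3" "v \<noteq> w"
  shows "syndromes v \<inter> syndromes w = {}"
proof -
  have False if s: "s \<in> syndromes v" "s \<in> syndromes w" for s
  proof -
    obtain x y where "x \<in> fibre s" "hamming_weight x = v" "y \<in> fibre s" "hamming_weight y = w"
      using s unfolding mem_syndromes_iff by blast
    then show False using fibre_eqI[of x s y] assms by auto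
  qed
  then show ?thesis by blast
qed

lemma card_syndromes_1: "card (syndromes 1) = CARD('n) * (CARD('a) - 1)"
proof -
  have "inj_on ((*v) H) {x. hamming_weight x = 1}"
    by (rule inj_onI, rule fibre_eqI) (auto simp: fibre_def)
  then have "card (syndromes 1) = card {x :: 'a ^ 'n. hamming_weight x = 1}"
    unfolding syndromes_def by (rule card_image)
  then show ?thesis by (simp add: card_hamming_weight_eq)
qed

lemma coset_weight_syndrome: "s \<in> syndromes w \<Longrightarrow> w \<le> 2 \<Longrightarrow> coset_weight (fibre s) = w"
  using coset_weight_fibre by (auto simp: mem_syndromes_iff)

text \<open>The syndromes of cosets of weight at least 2. Taking a complement lets them be counted
  before it is known that each such coset has a vector of weight 2.\<close>

definition heavy_syndromes :: "('a ^ 3) set" where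
  "heavy_syndromes = - (syndromes 0 \<union> syndromes 1)"

lemma card_heavy_syndromes_add:
  "card heavy_syndromes + (1 + CARD('n) * (CARD('a) - 1)) = CARD('a) ^ 3"
proof -
  have "card (syndromes 0 \<union> syndromes 1) = 1 + CARD('n) * (CARD('a) - 1)"
    using syndromes_disjoint[of 0 1] card_syndromes_1
    by (subst card_Un_disjoint) (simp_all add: syndromes_0)
  moreover have "card A + card (- A) = CARD('a) ^ 3" for A :: "('a ^ 3) set"
    using card_Un_disjoint[of A "- A"] by simp
  ultimately show ?thesis unfolding heavy_syndromes_def by (metis add.commute)
qed

text \<open>A fibre with a vector of weight at most 1 has none of weight 2, so the heavy fibres
  already contain all vectors of weight 2.\<close>

lemma sum_weight_count_2:
  "(\<Sum>s\<in>heavy_syndromes. weight_count 2 (fibre s)) = (CARD('n) choose 2) * (CARD('a) - 1) ^ 2"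
proof -
  have zero: "weight_count 2 (fibre s) = 0" if s: "s \<notin> heavy_syndromes" for s
  proof -
    obtain x where "x \<in> fibre s" "hamming_weight x = 0 \<or> hamming_weight x = 1"
      using s by (auto simp: heavy_syndromes_def mem_syndromes_iff)
    then show ?thesis using weight_count_eq_0[of x s 2] by auto
  qed
  have "(\<Sum>s\<in>heavy_syndromes. weight_count 2 (fibre s)) = (\<Sum>s\<in>UNIV. weight_count 2 (fibre s))"
    by (rule sum.mono_neutral_left) (auto simp: zero)
  also have "\<dots> = (\<Sum>s\<in>UNIV. of_nat (card {x \<in> {x. hamming_weight x = 2}. H *v x = s}) * 1)"
  proof (rule sum.cong)
    fix s
    have "{x \<in> {x. hamming_weight x = 2}. H *v x = s} = {x \<in> fibre s. hamming_weight x = 2}"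
      by (auto simp: fibre_def)
    then show "weight_count 2 (fibre s) = of_nat (card {x \<in> {x. hamming_weight x = 2}. H *v x = s}) * 1"
      by (simp add: weight_count_def)
  qed simp
  also have "\<dots> = (\<Sum>x\<in>{x :: 'a ^ 'n. hamming_weight x = 2}. 1)"
    by (rule sum_fun_comp[symmetric]) auto
  finally show ?thesis by (simp add: card_hamming_weight_eq)
qed

text \<open>For \<open>n = q + 2\<close> double counting of the vectors of weight 2 forces equality in
  \<open>two_card_weight_2_le\<close> for every heavy syndrome.\<close>

lemma
  assumes len: "CARD('n) = CARD('a) + 2"
  shows card_heavy_syndromes: "card heavy_syndromes = (CARD('a) - 1) * (CARD('a)\<^sup>2 - 1)"
    and weight_count_2_heavy: "\<And>s. s \<in> heavy_syndromes \<Longrightarrow> 2 * weight_count 2 (fibre s) = CARD('n)"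
proof -
  \<comment> \<open>Writing \<open>q = p + 1\<close> avoids truncated subtraction in the polynomial
    identities.\<close>
  obtain p where p: "CARD('a) = Suc p" using card_field_ge_2[where 'a = 'a] by (cases "CARD('a)") auto
  have n: "CARD('n) = p + 3" by (simp add: len p)
  have "card heavy_syndromes + (1 + (p + 3) * p) = (p + 1) ^ 3"
    using card_heavy_syndromes_add unfolding n p by simp
  \<comment> \<open>This is \<open>(q - 1) * (q\<^sup>2 - 1)\<close>, because
    \<open>q\<^sup>2 - 1 = p * (p + 2)\<close>.\<close>
  then have card: "card heavy_syndromes = p\<^sup>2 * (p + 2)"
    by (simp add: power3_eq_cube power2_eq_square algebra_simps)
  then show "card heavy_syndromes = (CARD('a) - 1) * (CARD('a)\<^sup>2 - 1)"
    by (simp add: p power2_eq_square algebra_simps)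
  have choose: "2 * (CARD('n) choose 2) = (p + 3) * (p + 2)"
  proof -
    have "2 * (m choose 2) = m * (m - 1)" for m :: nat
      by (cases m) (simp_all add: choose_two)
    from this[of "p + 3"] show ?thesis unfolding n by simp
  qed
  have "(\<Sum>s\<in>heavy_syndromes. 2 * weight_count 2 (fibre s)) = (p + 3) * (p + 2) * p\<^sup>2"
    unfolding sum_distrib_left[symmetric] sum_weight_count_2 mult.assoc[symmetric] choose by (simp add: p)
  also have "\<dots> = (\<Sum>s\<in>heavy_syndromes. CARD('n))"
    unfolding n by (simp add: card algebra_simps)
  finally have "(\<Sum>s\<in>heavy_syndromes. 2 * weight_count 2 (fibre s)) = (\<Sum>s\<in>heavy_syndromes. CARD('n))" .
  then show "2 * weight_count 2 (fibre s) = CARD('n)" if "s \<in> heavy_syndromes" for s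
    by (rule sum_mono_inv) (use that two_card_weight_2_le in auto)
qed

text \<open>A heavy fibre has \<open>n / 2 > 0\<close> vectors of weight 2, which excludes cosets of
  weight 3 or more.\<close>

lemma heavy_syndromes_eq:
  assumes "CARD('n) = CARD('a) + 2"
  shows "heavy_syndromes = syndromes 2"
proof
  show "syndromes 2 \<subseteq> heavy_syndromes"
    using syndromes_disjoint[of 0 2] syndromes_disjoint[of 1 2] by (auto simp: heavy_syndromes_def)
  show "heavy_syndromes \<subseteq> syndromes 2"
  proof
    fix s assume "s \<in> heavy_syndromes"
    then have "2 * weight_count 2 (fibre s) = CARD('n)"
      by (rule weight_count_2_heavy[OF assms])
    then have "weight_count 2 (fibre s) \<noteq> 0"
      using length_ge by linarith
    then have "{x \<in> fibre s. hamming_weight x = 2} \<noteq> {}"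
      unfolding weight_count_def by force
    then show "s \<in> syndromes 2" by (auto simp: mem_syndromes_iff)
  qed
qed

lemma syndromes_cover:
  assumes "CARD('n) = CARD('a) + 2"
  obtains w where "s \<in> syndromes w" "w \<le> 2"
  using heavy_syndromes_eq[OF assms] unfolding heavy_syndromes_def
  by (metis Compl_iff Un_iff le_refl one_le_numeral zero_le)

lemma coset_weight_fibre_iff:
  assumes "CARD('n) = CARD('a) + 2"
  shows "coset_weight (fibre s) = w \<longleftrightarrow> s \<in> syndromes w \<and> w \<le> 2"
  using coset_weight_syndrome syndromes_cover[OF assms, of s] by metis

lemma cosets_of_weight:
  assumes "CARD('n) = CARD('a) + 2"
  shows "{V \<in> cosets (fibre 0). coset_weight V = w} = (if w \<le> 2 then fibre ` syndromes w else {})"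
proof -
  have "{V \<in> cosets (fibre 0). coset_weight V = w} = fibre ` {s. coset_weight (fibre s) = w}"
    unfolding cosets_eq_range_fibre by blast
  then show ?thesis unfolding coset_weight_fibre_iff[OF assms] by simp
qed

section \<open>Dimension, minimum distance and covering radius\<close>

lemma subspace_fibre_0: "vec.subspace (fibre 0)"
  by (auto intro!: vec.subspaceI simp: fibre_def matrix_vector_right_distrib vector_scalar_commute)

lemma dim_fibre_0: "vec.dim (fibre 0) = CARD('n) - 3"
proof -
  \<comment> \<open>Both sides count the code: by its dimension, and as the kernel vectors supported
    in all coordinates.\<close>
  have "CARD('a) ^ vec.dim (fibre 0) = CARD('a) ^ (CARD('n) - 3)"
    using card_vec_subspace[OF subspace_fibre_0] card_fibre_supported[of UNIV 0] length_ge by simp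
  then show ?thesis using card_field_ge_2[where 'a = 'a] by (simp add: power_inject_exp)
qed

lemma min_distance_fibre_0:
  assumes "CARD('n) \<ge> 4"
  shows "min_distance (fibre 0) = 4"
  unfolding min_distance_def
proof (rule Least_equality)
  \<comment> \<open>The equation for \<open>j = 4\<close> contains only the zero word and the words
    of weight 4, so there are \<open>(n choose 4) * (q - 1) > 0\<close> of the latter.\<close>
  have "(\<Sum>w\<le>4. weight_count w (fibre 0) * ((CARD('n) - w) choose (4 - w))) = (CARD('n) choose 4) * CARD('a)"
    using weight_count_transform[of 4 0] assms by simp
  then have "(CARD('n) choose 4) + weight_count 4 (fibre 0) = (CARD('n) choose 4) * CARD('a)"
    using weight_count_kernel by (simp add: eval_nat_numeral)
  moreover have "(CARD('n) choose 4) * CARD('a) \<ge> (CARD('n) choose 4) * 2"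
    using card_field_ge_2[where 'a = 'a] by simp
  moreover have "(CARD('n) choose 4) > 0"
    using assms by simp
  ultimately have "weight_count 4 (fibre 0) \<noteq> 0" by linarith
  then have "{x \<in> fibre 0. hamming_weight x = 4} \<noteq> {}"
    unfolding weight_count_def by force
  then obtain x where "x \<in> fibre 0" "hamming_weight x = 4" by blast
  moreover from this have "x \<noteq> 0" by auto
  ultimately show "\<exists>x\<in>fibre 0. \<exists>y\<in>fibre 0. x \<noteq> y \<and> hamming_dist x y = 4"
    using zero_in_fibre_0 by (intro bexI[of _ x] bexI[of _ 0]) (simp_all add: hamming_dist_eq_weight)
next
  fix d assume "\<exists>x\<in>fibre 0. \<exists>y\<in>fibre 0. x \<noteq> y \<and> hamming_dist x y = d"
  then obtain x y where "x \<in> fibre 0" "y \<in> fibre 0" "x \<noteq> y" "hamming_weight (x - y) = d"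
    by (auto simp: hamming_dist_eq_weight)
  then show "4 \<le> d"
    using light_kernel[of "x - y"] by (force simp: fibre_def matrix_vector_mult_diff_distrib)
qed

lemma covering_radius_fibre_0:
  assumes "CARD('n) = CARD('a) + 2"
  shows "covering_radius (fibre 0) = 2"
  unfolding covering_radius_def
proof (rule Least_equality)
  show "\<forall>v. \<exists>c\<in>fibre 0. hamming_dist v c \<le> 2"
  proof
    fix v
    obtain w where "H *v v \<in> syndromes w" "w \<le> 2" using syndromes_cover[OF assms] .
    then obtain x where "x \<in> fibre (H *v v)" "hamming_weight x \<le> 2"
      by (auto simp: mem_syndromes_iff)
    then show "\<exists>c\<in>fibre 0. hamming_dist v c \<le> 2"
      by (intro bexI[of _ "v - x"])
        (simp_all add: hamming_dist_eq_weight fibre_def matrix_vector_mult_diff_distrib)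
  qed
next
  fix R assume R: "\<forall>v. \<exists>c\<in>fibre 0. hamming_dist v c \<le> R"
  \<comment> \<open>For the lower bound, a coset of weight 2 must exist, that is,
    \<open>(q - 1) * (q\<^sup>2 - 1)\<close> must be positive.\<close>
  have "CARD('a)\<^sup>2 - 1 > 0"
    using one_less_power[of "CARD('a)" 2] card_field_ge_2[where 'a = 'a] by simp
  then have "card heavy_syndromes \<noteq> 0"
    using card_heavy_syndromes[OF assms] card_field_ge_2[where 'a = 'a] by simp
  then obtain s where s: "s \<in> syndromes 2"
    using heavy_syndromes_eq[OF assms] by force
  obtain v where v: "v \<in> fibre s" using fibre_nonempty by blast
  obtain c where c: "c \<in> fibre 0" "hamming_weight (v - c) \<le> R"
    using R by (auto simp: hamming_dist_eq_weight)
  have "v - c \<in> fibre s"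
    using v c(1) by (simp add: fibre_def matrix_vector_mult_diff_distrib)
  then have "s \<in> syndromes (hamming_weight (v - c))"
    unfolding mem_syndromes_iff by blast
  then have "hamming_weight (v - c) \<ge> 2"
    using s syndromes_disjoint[of 2 "hamming_weight (v - c)"] by (cases "hamming_weight (v - c) \<ge> 2") auto
  then show "2 \<le> R" using c(2) by simp
qed

end

section \<open>The hyperoval in even characteristic\<close>

text \<open>Otherwise the nonzero elements split into pairs \<open>{x, - x}\<close> and
  \<open>q - 1\<close> is even.\<close>

lemma two_eq_zero_of_even_card:
  assumes "even CARD('a::{field,finite})"
  shows "(2::'a) = 0"
proof (rule ccontr)
  assume "(2::'a) \<noteq> 0"
  then have ne: "x \<noteq> - x" if "x \<noteq> 0" for x :: 'a
    using that by (metis add_eq_0_iff mult_2 mult_eq_0_iff)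
  let ?P = "(\<lambda>x::'a. {x, - x}) ` (UNIV - {0})"
  have "2 * card ?P = card (\<Union>?P)"
  proof (rule card_partition)
    show "card c = 2" if c: "c \<in> ?P" for c
    proof -
      obtain x where "c = {x, - x}" "x \<noteq> 0" using c by blast
      then show ?thesis using ne[of x] by simp
    qed
    show "c \<inter> d = {}" if cd: "c \<in> ?P" "d \<in> ?P" "c \<noteq> d" for c d
    proof -
      obtain x where "c = {x, - x}" using cd(1) by (rule imageE)
      moreover obtain y where "d = {y, - y}" using cd(2) by (rule imageE)
      ultimately show ?thesis using cd(3) by auto
    qed
  qed simp_all
  also have "\<Union>?P = UNIV - {0}" by auto
  also have "card (UNIV - {0::'a}) = CARD('a) - 1" by (simp add: card_Diff_singleton)
  finally have "even (CARD('a) - 1)" by (metis dvd_triv_left)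
  then show False using assms by (simp add: even_diff_nat)
qed

text \<open>\<open>(l, m, n)\<close> are line coordinates of the secant through \<open>Q\<close> and
  \<open>R\<close>, written out in each case; no third point of the hyperoval lies on it.\<close>

lemma hyperoval_secant:
  fixes Q R :: "'a::field ^ 3"
  assumes char2: "(2::'a) = 0"
    and pts: "Q \<in> hyperoval_points" "R \<in> hyperoval_points" "Q \<noteq> R"
  shows "\<exists>l m n. l * Q $ 1 + m * Q $ 2 + n * Q $ 3 = 0 \<and> l * R $ 1 + m * R $ 2 + n * R $ 3 = 0 \<and>
    (\<forall>P \<in> hyperoval_points - {Q, R}. l * P $ 1 + m * P $ 2 + n * P $ 3 \<noteq> 0)"
    (is "?S Q R")
proof -
  have neg: "- x = x" for x :: 'a
    using char2 by (metis add_eq_0_iff mult_2 mult_zero_left)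
  have sq: "x\<^sup>2 = y\<^sup>2 \<longleftrightarrow> x = y" for x y :: 'a
    using neg power2_eq_iff by metis
  have sum_0: "x + y = 0 \<longleftrightarrow> x = y" for x y :: 'a
    using neg by (metis add_eq_0_iff)
  have dbl: "x + x = 0" "x + (x + y) = y" for x y :: 'a
    by (simp_all add: add.assoc[symmetric] char2 flip: mult_2)
  let ?A = "\<lambda>t::'a. vector [1, t, t\<^sup>2] :: 'a ^ 3"
  let ?X = "vector [0, 0, 1] :: 'a ^ 3"
  let ?Y = "vector [0, 1, 0] :: 'a ^ 3"
  have ball: "(\<forall>P \<in> hyperoval_points - B. F P) \<longleftrightarrow>
      (\<forall>t. ?A t \<in> B \<or> F (?A t)) \<and> (?X \<in> B \<or> F ?X) \<and> (?Y \<in> B \<or> F ?Y)" for B F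
    unfolding hyperoval_points_def by blast
  have sym: "?S U V" if "?S V U" for U V
    using that unfolding insert_commute[of U V] by blast
  \<comment> \<open>On \<open>?A t\<close> the form is the quadratic in \<open>t\<close> with roots
    \<open>u\<close> and \<open>v\<close>; on \<open>?X\<close> it is 1, and on \<open>?Y\<close> it
    is \<open>u + v\<close>, nonzero in characteristic 2.\<close>
  have secant_AA: "?S (?A u) (?A v)" if "u \<noteq> v" for u v
  proof (intro exI conjI)
    show "u * v * ?A u $ 1 + (u + v) * ?A u $ 2 + 1 * ?A u $ 3 = 0"
      by (simp add: algebra_simps power2_eq_square dbl)
    show "u * v * ?A v $ 1 + (u + v) * ?A v $ 2 + 1 * ?A v $ 3 = 0"
      by (simp add: algebra_simps power2_eq_square dbl)
    have "u * v * ?A t $ 1 + (u + v) * ?A t $ 2 + 1 * ?A t $ 3 = (t + u) * (t + v)" for t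
      by (simp add: algebra_simps power2_eq_square)
    then show "\<forall>P \<in> hyperoval_points - {?A u, ?A v}. u * v * P $ 1 + (u + v) * P $ 2 + 1 * P $ 3 \<noteq> 0"
      unfolding ball using that by (auto simp: sum_0)
  qed
  have secant_AX: "?S (?A u) ?X" for u
  proof (intro exI conjI)
    show "u * ?A u $ 1 + 1 * ?A u $ 2 + 0 * ?A u $ 3 = 0" "u * ?X $ 1 + 1 * ?X $ 2 + 0 * ?X $ 3 = 0"
      by (simp_all add: sum_0 char2)
    show "\<forall>P \<in> hyperoval_points - {?A u, ?X}. u * P $ 1 + 1 * P $ 2 + 0 * P $ 3 \<noteq> 0"
      unfolding ball by (auto simp: sum_0)
  qed
  \<comment> \<open>\<open>?Y\<close> is the nucleus of the conic formed by the other points. The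
    tangent at \<open>?A u\<close> passes through it and meets no other \<open>?A t\<close>, because
    squaring is injective in characteristic 2.\<close>
  have secant_AY: "?S (?A u) ?Y" for u
  proof (intro exI conjI)
    show "u\<^sup>2 * ?A u $ 1 + 0 * ?A u $ 2 + 1 * ?A u $ 3 = 0" "u\<^sup>2 * ?Y $ 1 + 0 * ?Y $ 2 + 1 * ?Y $ 3 = 0"
      by (simp_all add: sum_0 char2)
    show "\<forall>P \<in> hyperoval_points - {?A u, ?Y}. u\<^sup>2 * P $ 1 + 0 * P $ 2 + 1 * P $ 3 \<noteq> 0"
      unfolding ball by (auto simp: sum_0 sq)
  qed
  have secant_XY: "?S ?X ?Y"
  proof (intro exI conjI)
    show "1 * ?X $ 1 + 0 * ?X $ 2 + 0 * ?X $ 3 = 0" "1 * ?Y $ 1 + 0 * ?Y $ 2 + 0 * ?Y $ 3 = 0"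
      by simp_all
    show "\<forall>P \<in> hyperoval_points - {?X, ?Y}. 1 * P $ 1 + 0 * P $ 2 + 0 * P $ 3 \<noteq> 0"
      unfolding ball by auto
  qed
  consider (AA) u v where "Q = ?A u" "R = ?A v" | (AX) u where "Q = ?A u" "R = ?X"
    | (AY) u where "Q = ?A u" "R = ?Y" | (XA) u where "Q = ?X" "R = ?A u"
    | (YA) u where "Q = ?Y" "R = ?A u" | (XY) "Q = ?X" "R = ?Y" | (YX) "Q = ?Y" "R = ?X"
    using pts unfolding hyperoval_points_def by blast
  then show ?thesis
  proof cases
    case (AA u v)
    then have "u \<noteq> v" using pts(3) by blast
    then show ?thesis unfolding AA by (rule secant_AA)
  next
    case AX
    then show ?thesis using secant_AX by simp
  next
    case AY
    then show ?thesis using secant_AY by simp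
  next
    case (XA u)
    then show ?thesis using sym[OF secant_AX] by simp
  next
    case (YA u)
    then show ?thesis using sym[OF secant_AY] by simp
  next
    case XY
    then show ?thesis using secant_XY by simp
  next
    case YX
    then show ?thesis using sym[OF secant_XY] by simp
  qed
qed

text \<open>Apply the linear form of the secant through \<open>Q\<close> and \<open>R\<close> to the
  relation: only the term of \<open>P\<close> survives, with a nonzero factor.\<close>

lemma hyperoval_independent:
  fixes P Q R :: "'a::field ^ 3"
  assumes char2: "(2::'a) = 0"
    and pts: "P \<in> hyperoval_points" "Q \<in> hyperoval_points" "R \<in> hyperoval_points"
    and dist: "P \<noteq> Q" "P \<noteq> R" "Q \<noteq> R"
    and eq: "a *s P + b *s Q + c *s R = 0"
  shows "a = 0"
proof -
  obtain l m n where Q: "l * Q $ 1 + m * Q $ 2 + n * Q $ 3 = 0"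
    and R: "l * R $ 1 + m * R $ 2 + n * R $ 3 = 0"
    and P: "l * P $ 1 + m * P $ 2 + n * P $ 3 \<noteq> 0"
    using hyperoval_secant[OF char2 pts(2,3) dist(3)] pts(1) dist by blast
  have e: "a * P $ 1 + b * Q $ 1 + c * R $ 1 = 0" "a * P $ 2 + b * Q $ 2 + c * R $ 2 = 0"
      "a * P $ 3 + b * Q $ 3 + c * R $ 3 = 0"
    using eq by (auto simp: vec_eq_iff)
  have "a * (l * P $ 1 + m * P $ 2 + n * P $ 3) = 0"
    using e Q R by algebra
  then show ?thesis using P by simp
qed

lemma hyperoval_light_kernel:
  fixes H :: "'a::{field,finite} ^ 'n ^ 3"
  assumes char2: "(2::'a) = 0"
    and H: "hyperoval_parity_check H"
    and len: "CARD('n) \<ge> 3"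
    and ker: "H *v x = 0"
    and light: "hamming_weight x \<le> 3"
  shows "x = 0"
proof (rule ccontr)
  obtain p c where p: "bij_betw p (UNIV :: 'n set) hyperoval_points"
    and c: "\<And>j. c j \<noteq> 0" "\<And>j. column j H = c j *s p j"
    using H unfolding hyperoval_parity_check_def by blast
  assume "x \<noteq> 0"
  then obtain i where i: "x $ i \<noteq> 0" by (auto simp: vec_eq_iff)
  \<comment> \<open>Padding the support to three coordinates treats weights 1, 2 and 3 uniformly:
    the kernel equation becomes a relation between three distinct hyperoval points.\<close>
  obtain S where S: "support x \<subseteq> S" "card S = 3"
    using light len exists_subset_between[of "support x" 3 UNIV] by (auto simp: hamming_weight_def)
  have "i \<in> S" using i S(1) by blast
  then have "card (S - {i}) = 2" using S(2) by simp
  then obtain j k where jk: "S - {i} = {j, k}" "j \<noteq> k" by (meson card_2_iff)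
  then have ijk: "S = {i, j, k}" "i \<noteq> j" "i \<noteq> k" using \<open>i \<in> S\<close> by auto
  have "0 = (\<Sum>l\<in>UNIV. x $ l *s column l H)"
    using ker by (simp add: matrix_mult_sum)
  also have "\<dots> = (\<Sum>l\<in>S. x $ l *s column l H)"
    by (rule sum.mono_neutral_right) (use S(1) in auto)
  also have "\<dots> = (x $ i * c i) *s p i + (x $ j * c j) *s p j + (x $ k * c k) *s p k"
    using ijk jk(2) by (simp add: c(2) add.assoc)
  finally have "(x $ i * c i) *s p i + (x $ j * c j) *s p j + (x $ k * c k) *s p k = 0" by simp
  moreover have "p l \<in> hyperoval_points" "p l = p l' \<longleftrightarrow> l = l'" for l l'
    using p by (auto simp: bij_betw_def inj_on_def)
  ultimately have "x $ i * c i = 0"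
    using ijk jk(2) by (intro hyperoval_independent[OF char2, of "p i" "p j" "p k"]) auto
  then show False using i c(1) by simp
qed

text \<open>Through the bijection in \<open>hyperoval_parity_check\<close> this count fixes the
  length of the code. The second coordinate recovers \<open>t\<close>, and the first separates the
  two extra points.\<close>

lemma card_hyperoval_points: "card (hyperoval_points :: ('a::{field,finite} ^ 3) set) = CARD('a) + 2"
proof -
  let ?A = "\<lambda>t::'a. vector [1, t, t\<^sup>2] :: 'a ^ 3"
  have "inj ?A"
    by (rule injI) (metis vector_3(2))
  then have "card (range ?A) = CARD('a)" by (rule card_image)
  moreover have "card {vector [0, 0, 1], vector [0, 1, 0] :: 'a ^ 3} = 2"
    by (simp add: vec_eq_iff forall_3)
  moreover have "range ?A \<inter> {vector [0, 0, 1], vector [0, 1, 0] :: 'a ^ 3} = {}"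
    by (auto simp: vec_eq_iff forall_3)
  ultimately show ?thesis
    unfolding hyperoval_points_def by (subst card_Un_disjoint) auto
qed

section \<open>The coset distributions of the hyperoval code\<close>

theorem theorem6p5:
  fixes H :: "'a::{field,finite} ^ 'n ^ 3"
    and C :: "('a ^ 'n) set"
    and q n :: nat
  assumes "q = CARD('a)" and "even q" and "n = q + 2"
    and "hyperoval_parity_check H"
    and "C = parity_check_code H"
  shows "linear_code (q + 2) (q - 1) 4 C \<and> covering_radius C = 2 \<and>
    card {V \<in> cosets C. coset_weight V = 1} = (q + 2) * (q - 1) \<and>
    (\<forall>V \<in> cosets C. coset_weight V = 1 \<longrightarrow> dist_D1 n C V) \<and>
    card {V \<in> cosets C. coset_weight V = 2} = (q - 1) * (q\<^sup>2 - 1) \<and>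
    (\<forall>V \<in> cosets C. coset_weight V = 2 \<longrightarrow> dist_D2 ((q + 2) div 2) n C V) \<and>
    {V \<in> cosets C. coset_weight V = 3} = {}"
proof -
  have len: "CARD('n) = CARD('a) + 2"
    using assms(4) card_hyperoval_points[where 'a = 'a]
    unfolding hyperoval_parity_check_def by (metis bij_betw_same_card)
  have char2: "(2::'a) = 0"
    using assms(1,2) by (intro two_eq_zero_of_even_card) simp
  interpret distance_four_parity_check H
    by unfold_locales (use hyperoval_light_kernel[OF char2 assms(4)] len card_field_ge_2[where 'a = 'a] in auto)
  have C: "C = fibre 0"
    by (simp add: assms(5) parity_check_code_def fibre_def)
  have n: "n = CARD('n)" using assms len by simp
  \<comment> \<open>Distinct syndromes have distinct fibres, so cosets can be counted by
    syndromes.\<close>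
  have inj: "inj_on fibre A" for A
    using inj_fibre by (rule inj_on_subset) simp
  have "linear_code (q + 2) (q - 1) 4 C"
    unfolding linear_code_def C
    using subspace_fibre_0 dim_fibre_0 min_distance_fibre_0 len card_field_ge_2[where 'a = 'a] assms(1) by simp
  moreover have "card {V \<in> cosets C. coset_weight V = 1} = (q + 2) * (q - 1)"
    unfolding C cosets_of_weight[OF len] using card_syndromes_1 len assms(1) by (simp add: card_image[OF inj])
  moreover have "card {V \<in> cosets C. coset_weight V = 2} = (q - 1) * (q\<^sup>2 - 1)"
    unfolding C cosets_of_weight[OF len]
    using card_heavy_syndromes[OF len] heavy_syndromes_eq[OF len] assms(1) by (simp add: card_image[OF inj])
  moreover have "dist_D1 n C V" if V: "V \<in> cosets C" "coset_weight V = 1" for V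
  proof -
    have "V \<in> {V \<in> cosets (fibre 0). coset_weight V = 1}" using V C by simp
    then obtain s where s: "V = fibre s" "s \<in> syndromes 1"
      unfolding cosets_of_weight[OF len] by auto
    then show ?thesis
      unfolding C n using dist_D1_fibre by (auto simp: mem_syndromes_iff)
  qed
  moreover have "dist_D2 ((q + 2) div 2) n C V" if V: "V \<in> cosets C" "coset_weight V = 2" for V
  proof -
    have "V \<in> {V \<in> cosets (fibre 0). coset_weight V = 2}" using V C by simp
    then obtain s where s: "V = fibre s" "s \<in> syndromes 2"
      unfolding cosets_of_weight[OF len] by auto
    obtain x where x: "x \<in> fibre s" "hamming_weight x = 2"
      using s(2) by (auto simp: mem_syndromes_iff)
    have "2 * weight_count 2 (fibre s) = q + 2"
      using weight_count_2_heavy[OF len] heavy_syndromes_eq[OF len] s(2) len assms(1) by simp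
    then have "weight_count 2 (fibre s) = (q + 2) div 2" by simp
    then show ?thesis
      unfolding C n s(1) using weight_count_eq_0[OF x(1)] x(2) by (intro dist_D2_fibre) simp_all
  qed
  moreover have "{V \<in> cosets C. coset_weight V = 3} = {}"
    unfolding C cosets_of_weight[OF len] by simp
  moreover have "covering_radius C = 2"
    unfolding C by (rule covering_radius_fibre_0[OF len])
  ultimately show ?thesis by blast
qed

end
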